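(* Let $\mathbb{P}_{\mathrm{orig}}$, $\mathbb{P}_{\mathrm{full}}$, $\mathbb{P}_{\mathrm{sel}}$ be the path measures on $[0,T]$ of three diffusion models (the original model, and two modified, "unlearned", models) with common diffusion coefficient $g$ and score functions $s_{\theta_{\mathrm{orig}}}, s_{\theta_{\mathrm{full}}}, s_{\theta_{\mathrm{sel}}}:\mathbb{R}^d\times[0,T]\to\mathbb{R}^d$, and let $\Delta s_m := s_{\theta_m}-s_{\theta_{\mathrm{orig}}}$ for $m\in\{\mathrm{full},\mathrm{sel}\}$. Let $\mathcal{S}$ be a selected target region, which is either a set of times (a measurable $\mathcal{S}\subseteq[0,T]$, with complement $\mathcal{S}^c=[0,T]\setminus\mathcal{S}$) or a set of spatial frequencies ($\mathcal{S}\subseteq\Omega$, where $\Omega$ is the finite set of discrete Fourier frequencies, with complement $\mathcal{S}^c=\Omega\setminus\mathcal{S}$; for example the low-pass band $\mathcal{S}=\{\omega\in\Omega:|\omega|\le r\}$). Let $D_{\mathrm{KL}}(\mathbb{P}_{\mathrm{orig}}\,\|\,\mathbb{P}_m)$ and the regional divergences $D_{\mathrm{KL}}^{\mathcal{S}}$, $D_{\mathrm{KL}}^{\mathcal{S}^c}$ be as in the context. Assume: (i) Finite divergence: $D_{\mathrm{KL}}(\mathbb{P}_{\mathrm{orig}}\,\|\,\mathbb{P}_m)<\infty$ for $m\in\{\mathrm{full},\mathrm{sel}\}$, and $D_{\mathrm{KL}}(\mathbb{P}_{\mathrm{orig}}\,\|\,\mathbb{P}_{\mathrm{full}})>0$.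 (ii) Focused updates: there are constants $\mu\ge 1$ and $\eta\in[0,1]$ such that $\|\Delta s_{\mathrm{sel}}\|_2\ge\mu\,\|\Delta s_{\mathrm{full}}\|_2$ in $\mathcal{S}$ and $\|\Delta s_{\mathrm{sel}}\|_2\le\eta\,\|\Delta s_{\mathrm{full}}\|_2$ in $\mathcal{S}^c$. That is: - if $\mathcal{S}$ is a set of times: for all $x\in\mathbb{R}^d$, $\|\Delta s_{\mathrm{sel}}(x,t)\|_2\ge\mu\,\|\Delta s_{\mathrm{full}}(x,t)\|_2$ for $t\in\mathcal{S}$, and $\|\Delta s_{\mathrm{sel}}(x,t)\|_2\le\eta\,\|\Delta s_{\mathrm{full}}(x,t)\|_2$ for $t\in\mathcal{S}^c$; - if $\mathcal{S}$ is a set of frequencies: for all $x\in\mathbb{R}^d$ and $t\in[0,T]$, $\|\widehat{\Delta s}_{\mathrm{sel}}(\omega;x,t)\|_2\ge\mu\,\|\widehat{\Delta s}_{\mathrm{full}}(\omega;x,t)\|_2$ for $\omega\in\mathcal{S}$, and $\|\widehat{\Delta s}_{\mathrm{sel}}(\omega;x,t)\|_2\le\eta\,\|\widehat{\Delta s}_{\mathrm{full}}(\omega;x,t)\|_2$ for $\omega\in\mathcal{S}^c$, where $\widehat{\Delta s}_m(\omega;x,t)$ is the Fourier coefficient of $\Delta s_m(x,t)$ at frequency $\omega$. For $\beta>0$ and $m\in\{\mathrm{full},\mathrm{sel}\}$ define $$\mathcal{J}_\beta(m):=D_{\mathrm{KL}}^{\mathcal{S}}(\mathbb{P}_{\mathrm{orig}}\,\|\,\mathbb{P}_m)-\beta\,D_{\mathrm{KL}}^{\mathcal{S}^c}(\mathbb{P}_{\mathrm{orig}}\,\|\,\mathbb{P}_m),$$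 and let $$\lambda:=\frac{D_{\mathrm{KL}}^{\mathcal{S}^c}(\mathbb{P}_{\mathrm{orig}}\,\|\,\mathbb{P}_{\mathrm{full}})}{D_{\mathrm{KL}}(\mathbb{P}_{\mathrm{orig}}\,\|\,\mathbb{P}_{\mathrm{full}})}\in[0,1].$$ Then, in either case, for every $\beta>0$, $$\mathcal{J}_\beta(\mathrm{sel})-\mathcal{J}_\beta(\mathrm{full})\;\ge\;\Big[(\mu^2-1)(1-\lambda)+\beta(1-\eta^2)\lambda\Big]\,D_{\mathrm{KL}}(\mathbb{P}_{\mathrm{orig}}\,\|\,\mathbb{P}_{\mathrm{full}}).$$
   Context: Fix $T>0$, a dimension $d$, a drift $f:\mathbb{R}^d\times[0,T]\to\mathbb{R}^d$ and a diffusion coefficient $g:[0,T]\to\mathbb{R}$. A diffusion model with score function $s_\theta$ generates samples by running, from time $T$ to time $0$, the reverse-time SDE $dx_t=[f(x_t,t)-g(t)^2 s_\theta(x_t,t)]\,dt+g(t)\,d\bar w_t$ started from $x_T\sim\mathcal{N}(0,I)$; its path measure is the law of $(x_t)_{t\in[0,T]}$. $\mathbb{P}_{\mathrm{orig}}$ is the path measure of the original model, and $\mathbb{P}_{\mathrm{full}}$, $\mathbb{P}_{\mathrm{sel}}$ are those of two modified models (same $f$, $g$ and law of $x_T$, different score functions). All functions are measurable. Standing setting (Girsanov's theorem): for $m\in\{\mathrm{full},\mathrm{sel}\}$ the KL divergence between path measures is given by $$D_{\mathrm{KL}}(\mathbb{P}_{\mathrm{orig}}\,\|\,\mathbb{P}_m)=\frac12\int_0^T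 g(t)^2\,\mathbb{E}_{x_t}\big[\|\Delta s_m(x_t,t)\|_2^2\big]\,dt,$$ where $x_t$ is distributed according to the time-$t$ marginal of $\mathbb{P}_{\mathrm{orig}}$ (the same law for both values of $m$). Fourier coefficients: elements of $\mathbb{R}^d$ are viewed as (possibly multi-channel) images on a finite pixel grid, $\Omega$ is the corresponding finite set of discrete frequencies, and $\widehat{\Delta s}_m(\omega;x,t)$ is the discrete Fourier transform of $\Delta s_m(x,t)$ over the spatial dimensions at $\omega\in\Omega$, normalized to be unitary, so that Plancherel's identity $\|\Delta s_m(x,t)\|_2^2=\sum_{\omega\in\Omega}\|\widehat{\Delta s}_m(\omega;x,t)\|_2^2$ holds. Regional divergence: for a measurable set of times $\mathcal{W}\subseteq[0,T]$, $$D_{\mathrm{KL}}^{\mathcal{W}}(\mathbb{P}_{\mathrm{orig}}\,\|\,\mathbb{P}_m):=\frac12\int_{\mathcal{W}} g(t)^2\,\mathbb{E}_{x_t}\big[\|\Delta s_m(x_t,t)\|_2^2\big]\,dt;$$ for a set of frequencies $\mathcal{W}\subseteq\Omega$, $$D_{\mathrm{KL}}^{\mathcal{W}}(\mathbb{P}_{\mathrm{orig}}\,\|\,\mathbb{P}_m):=\frac12\int_0^T g(t)^2\sum_{\omega\in\mathcal{W}}\mathbb{E}_{x_t}\big[\|\widehat{\Delta s}_m(\omega;x_t,t)\|_2^2\big]\,dt.$$ In both cases $D_{\mathrm{KL}}=D_{\mathrm{KL}}^{\mathcal{S}}+D_{\mathrm{KL}}^{\mathcal{S}^c}$. The number $\lambda$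 is the proportion of the full-unlearning divergence that falls outside the selected region. *)

theory Defs
  imports "HOL-Probability.Probability"
begin

section \<open>Reverse-time diffusions and their path measures\<close>

text \<open>The law \<open>N(0, \<sigma>\<^sup>2 I)\<close> on \<open>\<real>\<^sup>d\<close>, for \<open>\<sigma> > 0\<close>.\<close>

definition isotropic_gaussian :: "real \<Rightarrow> (real ^ 'd::finite) measure" where
  "isotropic_gaussian \<sigma> = density lborel (\<lambda>y. ennreal (\<Prod>i\<in>UNIV. normal_density 0 \<sigma> (y $ i)))"

text \<open>A standard Brownian motion \<open>w\<close> run from time \<open>T\<close> down to time \<open>0\<close>. Here \<open>F t\<close> is the
  information carried by the times in \<open>[t, T]\<close>, so that \<open>F\<close> grows as \<open>t\<close> decreases.\<close>

definition reverse_brownian_motion ::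
  "real \<Rightarrow> 'w measure \<Rightarrow> (real \<Rightarrow> 'w measure) \<Rightarrow> (real \<Rightarrow> 'w \<Rightarrow> real ^ 'd::finite) \<Rightarrow> bool" where
  "reverse_brownian_motion T M F w \<longleftrightarrow>
     prob_space M \<and>
     (\<forall>t\<in>{0..T}. subalgebra M (F t)) \<and>
     (\<forall>t\<in>{0..T}. \<forall>u\<in>{0..T}. u \<le> t \<longrightarrow> sets (F t) \<subseteq> sets (F u)) \<and>
     (\<forall>t\<in>{0..T}. w t \<in> borel_measurable (F t)) \<and>
     (\<forall>\<xi>\<in>space M. w T \<xi> = 0 \<and> continuous_on {0..T} (\<lambda>t. w t \<xi>)) \<and>
     (\<forall>t\<in>{0..T}. \<forall>u\<in>{0..T}. u < t \<longrightarrow>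
        distr M borel (\<lambda>\<xi>. w u \<xi> - w t \<xi>) = isotropic_gaussian (sqrt (t - u)) \<and>
        prob_space.indep_set M
          (sets (vimage_algebra (space M) (\<lambda>\<xi>. w u \<xi> - w t \<xi>) borel)) (sets (F t)))"

text \<open>The stochastic integral of a deterministic integrand. A step function
  \<open>\<Sum> c * indicator {l<..r}\<close> is given by the list of its triples \<open>(c, l, r)\<close>.\<close>

definition step_function :: "(real \<times> real \<times> real) list \<Rightarrow> real \<Rightarrow> real" where
  "step_function \<phi> u = (\<Sum>(c, l, r)\<leftarrow>\<phi>. c * indicator {l<..r} u)"

definition step_integral ::
  "(real \<times> real \<times> real) list \<Rightarrow> (real \<Rightarrow> 'w \<Rightarrow> real ^ 'd::finite) \<Rightarrow> 'w \<Rightarrow> real ^ 'd" where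
  "step_integral \<phi> w \<xi> = (\<Sum>(c, l, r)\<leftarrow>\<phi>. c *\<^sub>R (w r \<xi> - w l \<xi>))"

text \<open>\<open>Y\<close> is (a version of) the integral of \<open>h\<close> against \<open>w\<close> over \<open>[a, b]\<close>: the \<open>L\<^sup>2\<close> limit of the
  integrals of step functions that converge to \<open>h\<close> in \<open>L\<^sup>2\<close>. By the Ito isometry the choice of the
  approximating sequence is immaterial; if \<open>h\<close> is not square integrable there is no such \<open>Y\<close>.\<close>

definition has_wiener_integral ::
  "'w measure \<Rightarrow> (real \<Rightarrow> 'w \<Rightarrow> real ^ 'd::finite) \<Rightarrow> (real \<Rightarrow> real) \<Rightarrow> real \<Rightarrow> real \<Rightarrow>
   ('w \<Rightarrow> real ^ 'd) \<Rightarrow> bool" where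
  "has_wiener_integral M w h a b Y \<longleftrightarrow>
     Y \<in> borel_measurable M \<and>
     (\<exists>\<phi> :: nat \<Rightarrow> (real \<times> real \<times> real) list.
        (\<forall>n. \<forall>(c, l, r)\<in>set (\<phi> n). a \<le> l \<and> l \<le> r \<and> r \<le> b) \<and>
        (\<lambda>n. \<integral>\<^sup>+u\<in>{a..b}. ennreal ((h u - step_function (\<phi> n) u)\<^sup>2) \<partial>lborel) \<longlonglongrightarrow> 0 \<and>
        (\<lambda>n. \<integral>\<^sup>+\<xi>. ennreal ((norm (step_integral (\<phi> n) w \<xi> - Y \<xi>))\<^sup>2) \<partial>M) \<longlonglongrightarrow> 0)"

text \<open>\<open>x\<close> is a weak solution, driven by \<open>w\<close>, of the reverse-time equation
  \<open>dx\<^sub>t = [f(x\<^sub>t, t) - g(t)\<^sup>2 s(x\<^sub>t, t)] dt + g(t) dw\<^sub>t\<close> started from \<open>x\<^sub>T \<sim> N(0, I)\<close>. In integrated form,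
  \<open>x\<^sub>t = x\<^sub>T - \<integral>\<^bsub>[t,T]\<^esub> [f(x\<^sub>u, u) - g(u)\<^sup>2 s(x\<^sub>u, u)] du - \<integral>\<^bsub>[t,T]\<^esub> g(u) dw\<^sub>u\<close>.\<close>

definition reverse_diffusion ::
  "real \<Rightarrow> (real ^ 'd::finite \<Rightarrow> real \<Rightarrow> real ^ 'd) \<Rightarrow> (real \<Rightarrow> real) \<Rightarrow>
   (real ^ 'd \<Rightarrow> real \<Rightarrow> real ^ 'd) \<Rightarrow>
   'w measure \<Rightarrow> (real \<Rightarrow> 'w measure) \<Rightarrow> (real \<Rightarrow> 'w \<Rightarrow> real ^ 'd) \<Rightarrow>
   (real \<Rightarrow> 'w \<Rightarrow> real ^ 'd) \<Rightarrow> bool" where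
  "reverse_diffusion T f g s M F w x \<longleftrightarrow>
     reverse_brownian_motion T M F w \<and>
     (\<forall>t\<in>{0..T}. x t \<in> borel_measurable (F t)) \<and>
     (\<forall>\<xi>\<in>space M. continuous_on {0..T} (\<lambda>t. x t \<xi>)) \<and>
     distr M borel (x T) = isotropic_gaussian 1 \<and>
     (AE \<xi> in M. set_integrable lborel {0..T}
        (\<lambda>u. f (x u \<xi>) u - (g u)\<^sup>2 *\<^sub>R s (x u \<xi>) u)) \<and>
     (\<forall>t\<in>{0..T}. has_wiener_integral M w g t T
        (\<lambda>\<xi>. x T \<xi> - x t \<xi>
           - (LINT u:{t..T}|lborel. f (x u \<xi>) u - (g u)\<^sup>2 *\<^sub>R s (x u \<xi>) u)))"

text \<open>The law of \<open>(x\<^sub>t)\<close>, \<open>t \<in> [0,T]\<close>, on the product \<open>\<sigma>\<close>-algebra. For continuous processes this is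
  the same information as the law on \<open>C([0,T])\<close>, whose Borel \<open>\<sigma>\<close>-algebra is the trace of the product
  \<open>\<sigma>\<close>-algebra.\<close>

definition path_measure ::
  "real \<Rightarrow> 'w measure \<Rightarrow> (real \<Rightarrow> 'w \<Rightarrow> real ^ 'd::finite) \<Rightarrow> (real \<Rightarrow> real ^ 'd) measure" where
  "path_measure T M x =
     distr M (\<Pi>\<^sub>M t\<in>{0..T}. borel) (\<lambda>\<xi>. \<lambda>t\<in>{0..T}. x t \<xi>)"

definition marginal :: "(real \<Rightarrow> real ^ 'd::finite) measure \<Rightarrow> real \<Rightarrow> (real ^ 'd) measure" where
  "marginal P t = distr P borel (\<lambda>y. y t)"

text \<open>\<open>D\<^sub>K\<^sub>L(P \<parallel> Q)\<close> with values in \<open>[0,\<infinity>]\<close>. The library's \<open>KL_divergence b Q P\<close> is \<open>D(P \<parallel> Q)\<close> as a real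
  number, meaningful only if \<open>P\<close> has a density with respect to \<open>Q\<close> whose logarithm is
  \<open>P\<close>-integrable. The negative part of that logarithm is always \<open>P\<close>-integrable, so the divergence is
  \<open>\<infinity>\<close> in all other cases.\<close>

definition kl_div :: "'a measure \<Rightarrow> 'a measure \<Rightarrow> ennreal" where
  "kl_div P Q =
     (if absolutely_continuous Q P \<and> integrable P (entropy_density (exp 1) Q P)
      then ennreal (KL_divergence (exp 1) Q P) else \<infinity>)"


section \<open>Images and their discrete Fourier transform\<close>

text \<open>The pixels of a grid of size \<open>\<Prod>i. N i\<close>; \<open>'k\<close> indexes the spatial dimensions. The set \<open>\<Omega>\<close> of
  discrete frequencies is represented by the same set: \<open>\<omega> i\<close> is a residue modulo \<open>N i\<close>, so that
  a frequency band centred at the origin is a set of such residues.\<close>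

definition grid :: "('k::finite \<Rightarrow> nat) \<Rightarrow> ('k \<Rightarrow> nat) set" where
  "grid N = {p. \<forall>i. p i < N i}"

text \<open>How a vector in \<open>\<real>\<^sup>d\<close> is read as an image: the coordinate \<open>j\<close> holds the value of the channel
  \<open>channel L j\<close> at the pixel \<open>pixel L j\<close>.\<close>

record ('d, 'c, 'k) image_layout =
  grid_size :: "'k \<Rightarrow> nat"
  channel :: "'d \<Rightarrow> 'c"
  pixel :: "'d \<Rightarrow> 'k \<Rightarrow> nat"

definition valid_layout :: "('d::finite, 'c::finite, 'k::finite) image_layout \<Rightarrow> bool" where
  "valid_layout L \<longleftrightarrow>
     bij_betw (\<lambda>j. (channel L j, pixel L j)) UNIV (UNIV \<times> grid (grid_size L))"

text \<open>The Fourier coefficient at \<open>\<omega>\<close> has one complex component for every channel.\<close>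

definition unitary_dft ::
  "('d::finite, 'c::finite, 'k::finite) image_layout \<Rightarrow> real ^ 'd \<Rightarrow> ('k \<Rightarrow> nat) \<Rightarrow> complex ^ 'c" where
  "unitary_dft L v \<omega> = (\<chi> c.
     (1 / of_real (sqrt (real (card (grid (grid_size L)))))) *
     (\<Sum>j | channel L j = c.
        of_real (v $ j) *
        cis (- 2 * pi * (\<Sum>i\<in>UNIV. real (\<omega> i) * real (pixel L j i) / real (grid_size L i)))))"


section \<open>Regions and regional divergences\<close>

datatype 'k region = Times "real set" | Frequencies "('k \<Rightarrow> nat) set"

fun is_region :: "real \<Rightarrow> ('d, 'c, 'k::finite) image_layout \<Rightarrow> 'k region \<Rightarrow> bool" where
  "is_region T L (Times W) \<longleftrightarrow> W \<in> sets lebesgue \<and> W \<subseteq> {0..T}"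
| "is_region T L (Frequencies W) \<longleftrightarrow> W \<subseteq> grid (grid_size L)"

fun region_compl :: "real \<Rightarrow> ('d, 'c, 'k::finite) image_layout \<Rightarrow> 'k region \<Rightarrow> 'k region" where
  "region_compl T L (Times W) = Times ({0..T} - W)"
| "region_compl T L (Frequencies W) = Frequencies (grid (grid_size L) - W)"

text \<open>In the next two definitions \<open>P\<close> is the path measure of the original model and \<open>\<Delta>\<close> is the
  difference between the score of the modified model and the original score.\<close>

definition girsanov_divergence ::
  "real \<Rightarrow> (real \<Rightarrow> real) \<Rightarrow> (real \<Rightarrow> real ^ 'd::finite) measure \<Rightarrow>
   (real ^ 'd \<Rightarrow> real \<Rightarrow> real ^ 'd) \<Rightarrow> ennreal" where
  "girsanov_divergence T g P \<Delta> =
     ennreal (1/2) * (\<integral>\<^sup>+t\<in>{0..T}. ennreal ((g t)\<^sup>2) *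
        (\<integral>\<^sup>+y. ennreal ((norm (\<Delta> y t))\<^sup>2) \<partial>marginal P t) \<partial>lebesgue)"

fun regional_divergence ::
  "real \<Rightarrow> (real \<Rightarrow> real) \<Rightarrow> ('d::finite, 'c::finite, 'k::finite) image_layout \<Rightarrow>
   (real \<Rightarrow> real ^ 'd) measure \<Rightarrow> (real ^ 'd \<Rightarrow> real \<Rightarrow> real ^ 'd) \<Rightarrow> 'k region \<Rightarrow> ennreal" where
  "regional_divergence T g L P \<Delta> (Times W) =
     ennreal (1/2) * (\<integral>\<^sup>+t\<in>W. ennreal ((g t)\<^sup>2) *
        (\<integral>\<^sup>+y. ennreal ((norm (\<Delta> y t))\<^sup>2) \<partial>marginal P t) \<partial>lebesgue)"
| "regional_divergence T g L P \<Delta> (Frequencies W) =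
     ennreal (1/2) * (\<integral>\<^sup>+t\<in>{0..T}. ennreal ((g t)\<^sup>2) *
        (\<Sum>\<omega>\<in>W. \<integral>\<^sup>+y. ennreal ((norm (unitary_dft L (\<Delta> y t) \<omega>))\<^sup>2) \<partial>marginal P t) \<partial>lebesgue)"

fun focused_updates ::
  "real \<Rightarrow> ('d::finite, 'c::finite, 'k::finite) image_layout \<Rightarrow> real \<Rightarrow> real \<Rightarrow>
   (real ^ 'd \<Rightarrow> real \<Rightarrow> real ^ 'd) \<Rightarrow> (real ^ 'd \<Rightarrow> real \<Rightarrow> real ^ 'd) \<Rightarrow> 'k region \<Rightarrow> bool" where
  "focused_updates T L \<mu> \<eta> \<Delta>full \<Delta>sel (Times W) \<longleftrightarrow>
     (\<forall>y. (\<forall>t\<in>W. norm (\<Delta>sel y t) \<ge> \<mu> * norm (\<Delta>full y t)) \<and>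
          (\<forall>t\<in>{0..T} - W. norm (\<Delta>sel y t) \<le> \<eta> * norm (\<Delta>full y t)))"
| "focused_updates T L \<mu> \<eta> \<Delta>full \<Delta>sel (Frequencies W) \<longleftrightarrow>
     (\<forall>y. \<forall>t\<in>{0..T}.
        (\<forall>\<omega>\<in>W. norm (unitary_dft L (\<Delta>sel y t) \<omega>) \<ge> \<mu> * norm (unitary_dft L (\<Delta>full y t) \<omega>)) \<and>
        (\<forall>\<omega>\<in>grid (grid_size L) - W.
           norm (unitary_dft L (\<Delta>sel y t) \<omega>) \<le> \<eta> * norm (unitary_dft L (\<Delta>full y t) \<omega>)))"

datatype model = Orig | Full | Sel

end

theory Submission
  imports Defs
begin

text \<open>Both kinds of regional divergence have the form
  \<open>1/2 \<integral>\<^bsub>A\<^esub> g(t)\<^sup>2 E[q(\<Delta>(x\<^sub>t, t))] dt\<close>: a set of times restricts \<open>A\<close> and keeps \<open>q = \<parallel>\<cdot>\<parallel>\<^sup>2\<close>, a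
  frequency band keeps \<open>A = [0, T]\<close> and restricts \<open>q\<close> to the energy in the band. The expression is
  additive in \<open>A\<close> and in \<open>q\<close>, so by Plancherel's identity the region and its complement add up to
  the whole divergence, and it is monotone, so the focusing assumption scales the divergence by at
  least \<open>\<mu>\<^sup>2\<close> inside and at most \<open>\<eta>\<^sup>2\<close> outside the region. The rest is arithmetic. Additivity needs
  the integrand to be measurable in \<open>t\<close>; this comes from the joint measurability of the
  continuous process \<open>x\<close>.\<close>

section \<open>Plancherel's identity on the grid\<close>

lemma grid_eq_PiE: "grid N = (\<Pi>\<^sub>E i\<in>UNIV. {..<N i})"
  by (auto simp: grid_def PiE_def Pi_def)

lemma finite_grid [simp]: "finite (grid N)"
  unfolding grid_eq_PiE by (rule finite_PiE) auto

lemma cis_sum: "finite A \<Longrightarrow> cis (sum f A) = (\<Prod>i\<in>A. cis (f i))"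
  by (induction rule: finite_induct) (auto simp: cis_mult [symmetric])

text \<open>For \<open>p \<noteq> q\<close> the summands are the powers of a number \<open>z\<close>
  with \<open>z ^ n = 1\<close> and \<open>z \<noteq> 1\<close>, so the geometric sum
  vanishes.\<close>

lemma sum_cis_roots_of_unity:
  assumes "p < n" "q < n"
  shows "(\<Sum>k<n. cis (2 * pi * (real k * (real p - real q) / real n)))
    = (if p = q then of_nat n else 0)"
proof (cases "p = q")
  case False
  define z where "z = cis (2 * pi * ((real p - real q) / real n))"
  have pow: "cis (2 * pi * (real k * (real p - real q) / real n)) = z ^ k" for k
    unfolding z_def Complex.DeMoivre by (rule arg_cong [where f = cis]) simp
  have n: "real n > 0" using assms by simp
  have "z ^ n = cis (2 * pi * (real p - real q))"
    unfolding z_def Complex.DeMoivre using n by (intro arg_cong [where f = cis]) simp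
  \<comment> \<open>The difference is taken in \<open>int\<close>, since \<open>p - q\<close> in
    \<open>nat\<close> would truncate when \<open>p < q\<close>.\<close>
  also have "\<dots> = cis (2 * pi * real_of_int (int p - int q))"
    by simp
  also have "\<dots> = 1"
    by (rule cis_multiple_2pi) simp
  finally have zn: "z ^ n = 1" .
  \<comment> \<open>If \<open>z = 1\<close>, then \<open>(p - q) / n\<close> is an integer
    \<open>m\<close>, nonzero because \<open>p \<noteq> q\<close>. Hence p and q are at least
    \<open>n\<close> apart, although both lie in \<open>{0..<n}\<close>.\<close>
  have "z \<noteq> 1"
  proof
    assume "z = 1"
    then have "cos (2 * pi * ((real p - real q) / real n)) = 1"
      unfolding z_def by (metis cis.sel(1) one_complex.sel(1))
    then obtain m :: int where "2 * pi * ((real p - real q) / real n) = of_int m * 2 * pi"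
      by (auto simp: cos_one_2pi_int)
    then have "2 * pi * ((real p - real q) / real n) = 2 * pi * of_int m"
      by (simp add: mult_ac)
    then have "(real p - real q) / real n = of_int m"
      by (metis mult_cancel_left pi_neq_zero mult_eq_0_iff zero_neq_numeral)
    then have "real p - real q = of_int m * real n"
      using n by (simp add: field_simps)
    then have eq: "int p - int q = m * int n"
      by (metis of_int_diff of_int_eq_iff of_int_mult of_int_of_nat_eq)
    then have "m \<noteq> 0" using False by auto
    then have "1 * int n \<le> \<bar>m\<bar> * int n"
      by (intro mult_right_mono) auto
    then have "int n \<le> \<bar>int p - int q\<bar>" by (simp add: eq abs_mult)
    then show False using assms by auto
  qed
  then show ?thesis
    using False zn unfolding pow by (simp add: geometric_sum)
qed simp

text \<open>Orthogonality of the characters of a product of cyclic groups. A character factors over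
  the spatial dimensions, so the sum over the grid is a product of one-dimensional sums, and a
  single dimension with \<open>p i \<noteq> q i\<close> makes it zero.\<close>

lemma sum_grid_characters:
  assumes "p \<in> grid N" "q \<in> grid N"
  shows "(\<Sum>\<omega>\<in>grid N. cis (2 * pi * (\<Sum>i\<in>UNIV. real (\<omega> i) * (real (p i) - real (q i)) / real (N i))))
    = (if p = q then of_nat (card (grid N)) else 0)"
proof -
  have "(\<Sum>\<omega>\<in>grid N. cis (2 * pi * (\<Sum>i\<in>UNIV. real (\<omega> i) * (real (p i) - real (q i)) / real (N i))))
      = (\<Sum>\<omega>\<in>grid N. \<Prod>i\<in>UNIV. cis (2 * pi * (real (\<omega> i) * (real (p i) - real (q i)) / real (N i))))"
    by (simp add: sum_distrib_left cis_sum)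
  also have "\<dots> = (\<Prod>i\<in>UNIV. \<Sum>k<N i. cis (2 * pi * (real k * (real (p i) - real (q i)) / real (N i))))"
    unfolding grid_eq_PiE by (rule prod_sum_PiE [symmetric]) auto
  also have "\<dots> = (\<Prod>i\<in>UNIV. if p i = q i then of_nat (N i) else 0)"
    using assms by (intro prod.cong refl sum_cis_roots_of_unity) (auto simp: grid_def)
  also have "\<dots> = (if p = q then of_nat (card (grid N)) else 0)"
    by (auto simp: grid_eq_PiE card_PiE fun_eq_iff)
  finally show ?thesis .
qed

text \<open>Expands \<open>z * cnj z\<close>. The identity is stated in the complex numbers to keep
  the phase differences as \<open>cis\<close> factors, which can then be summed over the
  frequencies.\<close>

lemma norm_sum_cis_squared:
  "complex_of_real ((norm (\<Sum>j\<in>A. complex_of_real (v j) * cis (\<theta> j)))\<^sup>2)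
    = (\<Sum>j\<in>A. \<Sum>k\<in>A. complex_of_real (v j * v k) * cis (\<theta> j - \<theta> k))"
proof -
  have "complex_of_real (v j) * cis (\<theta> j) * (complex_of_real (v k) * cis (- \<theta> k))
      = complex_of_real (v j * v k) * cis (\<theta> j - \<theta> k)" for j k
  proof -
    have "cis (\<theta> j - \<theta> k) = cis (\<theta> j) * cis (- \<theta> k)"
      by (simp add: cis_mult)
    then show ?thesis by (simp add: mult_ac)
  qed
  then show ?thesis
    unfolding complex_norm_square cnj_sum sum_product complex_cnj_mult complex_cnj_complex_of_real cis_cnj
    by (simp only:)
qed

text \<open>Within each channel the squared modulus expands into a double sum over coordinates.
  Summing over frequencies first removes the off-diagonal terms and leaves a factor \<open>n\<close>
  on the diagonal, which cancels the normalization.\<close>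

lemma plancherel_unitary_dft:
  assumes L: "valid_layout L"
  shows "(\<Sum>\<omega>\<in>grid (grid_size L). (norm (unitary_dft L v \<omega>))\<^sup>2) = (norm v)\<^sup>2"
proof -
  define N where "N = grid_size L"
  define n where "n = card (grid N)"
  define C where "C c = {j. channel L j = c}" for c
  define \<theta> where "\<theta> \<omega> j = - 2 * pi * (\<Sum>i\<in>UNIV. real (\<omega> i) * real (pixel L j i) / real (N i))" for \<omega> j
  define X where "X c \<omega> = (\<Sum>j\<in>C c. complex_of_real (v $ j) * cis (\<theta> \<omega> j))" for c \<omega>
  have pixel: "pixel L j \<in> grid N" for j
    using L bij_betwE unfolding valid_layout_def N_def by fastforce
  \<comment> \<open>The index type of the coordinates is nonempty, so the grid contains a
    pixel.\<close>
  then have "n > 0"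
    by (auto simp: n_def card_gt_0_iff)
  \<comment> \<open>Within one channel a pixel determines its coordinate, so equality of pixels, as
    delivered by orthogonality, means equality of coordinates.\<close>
  have inj: "j = k" if "j \<in> C c" "k \<in> C c" "pixel L j = pixel L k" for j k c
    using L that unfolding valid_layout_def bij_betw_def inj_on_def C_def by auto
  have dft: "(norm (unitary_dft L v \<omega>))\<^sup>2 = (\<Sum>c\<in>UNIV. (norm (X c \<omega>))\<^sup>2) / n" for \<omega>
  proof -
    have "unitary_dft L v \<omega> $ c = X c \<omega> / complex_of_real (sqrt (real n))" for c
      by (simp add: unitary_dft_def X_def C_def \<theta>_def n_def N_def)
    then show ?thesis
      by (simp add: norm_vec_def L2_set_def sum_nonneg norm_divide power_divide sum_divide_distrib)
  qed
  \<comment> \<open>The minus sign in the transform exchanges the roles of \<open>j\<close> and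
    \<open>k\<close>.\<close>
  have angle: "\<theta> \<omega> j - \<theta> \<omega> k
      = 2 * pi * (\<Sum>i\<in>UNIV. real (\<omega> i) * (real (pixel L k i) - real (pixel L j i)) / real (N i))"
    for \<omega> j k
    by (simp add: \<theta>_def right_diff_distrib diff_divide_distrib sum_subtractf)
  have channel: "(\<Sum>\<omega>\<in>grid N. (norm (X c \<omega>))\<^sup>2) = n * (\<Sum>j\<in>C c. (v $ j)\<^sup>2)" for c
  proof -
    have "complex_of_real (\<Sum>\<omega>\<in>grid N. (norm (X c \<omega>))\<^sup>2)
        = (\<Sum>\<omega>\<in>grid N. \<Sum>j\<in>C c. \<Sum>k\<in>C c. complex_of_real (v $ j * v $ k) * cis (\<theta> \<omega> j - \<theta> \<omega> k))"
      unfolding X_def of_real_sum norm_sum_cis_squared ..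
    \<comment> \<open>The sum over frequencies is moved innermost, where the orthogonality relation
      evaluates it.\<close>
    also have "\<dots> = (\<Sum>j\<in>C c. \<Sum>k\<in>C c. complex_of_real (v $ j * v $ k) *
        (\<Sum>\<omega>\<in>grid N. cis (\<theta> \<omega> j - \<theta> \<omega> k)))"
      by (subst sum.swap, intro sum.cong refl, subst sum.swap) (simp add: sum_distrib_left)
    also have "\<dots> = (\<Sum>j\<in>C c. \<Sum>k\<in>C c. if j = k then complex_of_real (n * (v $ j)\<^sup>2) else 0)"
      unfolding angle sum_grid_characters [OF pixel pixel]
      by (intro sum.cong refl) (auto simp: n_def power2_eq_square dest: inj)
    also have "\<dots> = complex_of_real (n * (\<Sum>j\<in>C c. (v $ j)\<^sup>2))"
      by (simp add: sum_distrib_left C_def)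
    finally show ?thesis
      by (simp only: of_real_eq_iff)
  qed
  have "(\<Sum>\<omega>\<in>grid N. (norm (unitary_dft L v \<omega>))\<^sup>2) = (\<Sum>c\<in>UNIV. \<Sum>j\<in>C c. (v $ j)\<^sup>2)"
    unfolding dft sum_divide_distrib [symmetric]
    by (subst sum.swap) (use \<open>n > 0\<close> in \<open>simp add: channel sum_distrib_left [symmetric]\<close>)
  \<comment> \<open>The fibres of \<open>channel L\<close> partition the coordinates.\<close>
  also have "\<dots> = (\<Sum>j\<in>UNIV. (v $ j)\<^sup>2)"
    using sum.group [of UNIV UNIV "channel L" "\<lambda>j. (v $ j)\<^sup>2"] by (simp add: C_def)
  also have "\<dots> = (norm v)\<^sup>2"
    by (simp add: norm_vec_def L2_set_def sum_nonneg)
  finally show ?thesis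
    by (simp add: N_def)
qed

lemma borel_measurable_unitary_dft [measurable]:
  "(\<lambda>v. unitary_dft L v \<omega>) \<in> borel_measurable borel"
  unfolding unitary_dft_def
  by (intro borel_measurable_continuous_onI continuous_intros)


section \<open>Energies along the original diffusion\<close>

text \<open>Rounding the time down to a multiple of \<open>1 / Suc n\<close> gives processes with
  countably many time values, which are jointly measurable. By continuity of the paths they converge
  pointwise to \<open>x\<close>.\<close>

lemma borel_measurable_continuous_process:
  fixes x :: "real \<Rightarrow> 'w \<Rightarrow> 'b::metric_space"
  assumes "a \<le> b"
    and x: "\<And>t. t \<in> {a..b} \<Longrightarrow> x t \<in> borel_measurable M"
    and cont: "\<And>\<xi>. \<xi> \<in> space M \<Longrightarrow> continuous_on {a..b} (\<lambda>t. x t \<xi>)"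
  shows "(\<lambda>(t, \<xi>). x t \<xi>) \<in> borel_measurable (restrict_space borel {a..b} \<Otimes>\<^sub>M M)"
proof -
  \<comment> \<open>Clamping to \<open>{a..b}\<close> extends the process to all real times with
    continuous paths, so rounded times that leave the interval do no harm.\<close>
  define r where "r t = max a (min b t)" for t
  have r: "r t \<in> {a..b}" for t
    using \<open>a \<le> b\<close> by (auto simp: r_def)
  let ?N = "(borel :: real measure) \<Otimes>\<^sub>M M"
  have "(\<lambda>z. x (r (fst z)) (snd z)) \<in> borel_measurable ?N"
  proof (rule borel_measurable_LIMSEQ_metric)
    fix n :: nat
    have [measurable]: "x (r t) \<in> borel_measurable M" for t
      using x [OF r] .
    show "(\<lambda>z. x (r (of_int \<lfloor>fst z * real (Suc n)\<rfloor> / real (Suc n))) (snd z)) \<in> borel_measurable ?N"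
      \<comment> \<open>The approximant depends on the time only through an integer, the
        floor.\<close>
      by (rule measurable_compose_countable
          [where f = "\<lambda>i z. x (r (of_int i / real (Suc n))) (snd z)"]) measurable
  next
    fix z assume "z \<in> space ?N"
    then have z: "snd z \<in> space M"
      by (auto simp: space_pair_measure)
    \<comment> \<open>The rounding error is at most \<open>1 / Suc n\<close>; using
      \<open>Suc n\<close> avoids a zero denominator.\<close>
    have "(\<lambda>n. of_int \<lfloor>fst z * real (Suc n)\<rfloor> / real (Suc n)) \<longlonglongrightarrow> fst z"
    proof (rule tendsto_sandwich)
      show "\<forall>\<^sub>F n in sequentially. fst z - 1 / real (Suc n) \<le> of_int \<lfloor>fst z * real (Suc n)\<rfloor> / real (Suc n)"
      proof (intro always_eventually allI)
        fix n
        have "fst z * real (Suc n) - 1 \<le> of_int \<lfloor>fst z * real (Suc n)\<rfloor>" by linarith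
        then show "fst z - 1 / real (Suc n) \<le> of_int \<lfloor>fst z * real (Suc n)\<rfloor> / real (Suc n)"
          by (simp add: pos_le_divide_eq left_diff_distrib del: of_nat_Suc)
      qed
      show "\<forall>\<^sub>F n in sequentially. of_int \<lfloor>fst z * real (Suc n)\<rfloor> / real (Suc n) \<le> fst z"
        by (intro always_eventually allI) (simp add: pos_divide_le_eq del: of_nat_Suc)
      show "(\<lambda>n. fst z - 1 / real (Suc n)) \<longlonglongrightarrow> fst z"
        using tendsto_diff [OF tendsto_const LIMSEQ_Suc [OF lim_1_over_n]] by simp
    qed simp
    moreover have "isCont (\<lambda>t. x (r t) (snd z)) t" for t
    proof -
      have "continuous_on UNIV (\<lambda>t. x (r t) (snd z))"
        by (rule continuous_on_compose2 [OF cont [OF z]])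
          (use r in \<open>auto simp: r_def [abs_def] intro!: continuous_intros\<close>)
      then show ?thesis
        by (simp add: continuous_on_eq_continuous_at)
    qed
    ultimately show "(\<lambda>n. x (r (of_int \<lfloor>fst z * real (Suc n)\<rfloor> / real (Suc n))) (snd z))
        \<longlonglongrightarrow> x (r (fst z)) (snd z)"
      using isCont_tendsto_compose by blast
  qed
  \<comment> \<open>Back to the interval: the inclusion of \<open>{a..b}\<close> into the real line
    is measurable, and \<open>r\<close> is the identity there.\<close>
  moreover have "(\<lambda>z. (fst z, snd z)) \<in> restrict_space borel {a..b} \<Otimes>\<^sub>M M \<rightarrow>\<^sub>M ?N"
    by (rule measurable_Pair
        [OF measurable_compose [OF measurable_fst measurable_restrict_space1 [OF measurable_ident_sets]]
          measurable_snd]) simp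
  ultimately have "(\<lambda>z. x (r (fst z)) (snd z)) \<in> borel_measurable (restrict_space borel {a..b} \<Otimes>\<^sub>M M)"
    using measurable_compose by fastforce
  then show ?thesis
    by (rule measurable_cong [THEN iffD1, rotated])
      (auto simp: r_def space_pair_measure space_restrict_space)
qed

section \<open>Energies: measurability in time, monotonicity and additivity\<close>

definition energy ::
  "(real \<Rightarrow> real) \<Rightarrow> (real \<Rightarrow> real ^ 'd::finite) measure \<Rightarrow> (real ^ 'd \<Rightarrow> ennreal) \<Rightarrow>
   (real ^ 'd \<Rightarrow> real \<Rightarrow> real ^ 'd) \<Rightarrow> real set \<Rightarrow> ennreal" where
  "energy g P q \<Delta> A = ennreal (1/2) * (\<integral>\<^sup>+t\<in>A. ennreal ((g t)\<^sup>2) *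
     (\<integral>\<^sup>+y. q (\<Delta> y t) \<partial>marginal P t) \<partial>lebesgue)"

locale original_diffusion =
  fixes T :: real and g :: "real \<Rightarrow> real" and M :: "'w measure"
    and x :: "real \<Rightarrow> 'w \<Rightarrow> real ^ 'd::finite" and P :: "(real \<Rightarrow> real ^ 'd) measure"
  assumes T_nonneg: "0 \<le> T"
    and g: "g \<in> borel_measurable (restrict_space borel {0..T})"
    and prob_M: "prob_space M"
    and x: "\<And>t. t \<in> {0..T} \<Longrightarrow> x t \<in> borel_measurable M"
    and x_cont: "\<And>\<xi>. \<xi> \<in> space M \<Longrightarrow> continuous_on {0..T} (\<lambda>t. x t \<xi>)"
    and P: "P = path_measure T M x"
begin

text \<open>Joint rather than sectionwise measurability, because \<open>\<Delta>\<close> is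
  evaluated along the moving point \<open>x t \<xi>\<close>.\<close>

definition perturbation :: "(real ^ 'd \<Rightarrow> real \<Rightarrow> real ^ 'd) \<Rightarrow> bool" where
  "perturbation \<Delta> \<longleftrightarrow>
     (\<lambda>(y, t). \<Delta> y t) \<in> borel_measurable (borel \<Otimes>\<^sub>M restrict_space borel {0..T})"

lemma marginal_P:
  assumes t: "t \<in> {0..T}"
  shows "marginal P t = distr M borel (x t)"
proof -
  have "(\<lambda>\<xi>. \<lambda>t\<in>{0..T}. x t \<xi>) \<in> measurable M (\<Pi>\<^sub>M t\<in>{0..T}. borel)"
    by (rule measurable_restrict) (rule x)
  moreover have "(\<lambda>y. y t) \<in> measurable (\<Pi>\<^sub>M t\<in>{0..T}. borel :: (real ^ 'd) measure) borel"
    using t by (rule measurable_component_singleton)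
  ultimately show ?thesis
    using t by (simp add: marginal_def P path_measure_def distr_distr comp_def)
qed

lemma borel_measurable_section:
  assumes \<Delta>: "perturbation \<Delta>" and q: "q \<in> borel_measurable borel" and t: "t \<in> {0..T}"
  shows "(\<lambda>y. q (\<Delta> y t)) \<in> borel_measurable (marginal P t)"
proof -
  have "(\<lambda>y. (y, t)) \<in> borel \<rightarrow>\<^sub>M borel \<Otimes>\<^sub>M restrict_space borel {0..T}"
    using t by (intro measurable_Pair2') (simp add: space_restrict_space)
  from measurable_compose [OF this \<Delta> [unfolded perturbation_def]]
  have "(\<lambda>y. \<Delta> y t) \<in> borel_measurable borel" by simp
  from measurable_compose [OF this q] show ?thesis
    by (simp add: marginal_def)
qed

text \<open>The measure \<open>marginal P t\<close> itself varies with \<open>t\<close>. Written as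
  an integral over the fixed space \<open>M\<close>, the mean has a jointly measurable integrand,
  and Tonelli's theorem gives measurability in \<open>t\<close>.\<close>

lemma borel_measurable_mean:
  assumes \<Delta>: "perturbation \<Delta>" and q: "q \<in> borel_measurable borel"
  shows "(\<lambda>t. \<integral>\<^sup>+y. q (\<Delta> y t) \<partial>marginal P t) \<in> borel_measurable (restrict_space borel {0..T})"
proof -
  interpret prob_space M by (rule prob_M)
  let ?R = "restrict_space borel {0..T} :: real measure"
  have "(\<lambda>(t, \<xi>). x t \<xi>) \<in> borel_measurable (?R \<Otimes>\<^sub>M M)"
    using T_nonneg x x_cont by (rule borel_measurable_continuous_process)
  then have "(\<lambda>z. (x (fst z) (snd z), fst z)) \<in> ?R \<Otimes>\<^sub>M M \<rightarrow>\<^sub>M borel \<Otimes>\<^sub>M ?R"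
    by (intro measurable_Pair) (auto simp: split_beta)
  from measurable_compose [OF measurable_compose [OF this \<Delta> [unfolded perturbation_def]] q]
  have "(\<lambda>(t, \<xi>). q (\<Delta> (x t \<xi>) t)) \<in> borel_measurable (?R \<Otimes>\<^sub>M M)"
    by (simp add: split_beta)
  then have "(\<lambda>t. \<integral>\<^sup>+\<xi>. q (\<Delta> (x t \<xi>) t) \<partial>M) \<in> borel_measurable ?R"
    by (rule borel_measurable_nn_integral)
  then show ?thesis
  proof (rule measurable_cong [THEN iffD1, rotated])
    fix t assume "t \<in> space ?R"
    then have t: "t \<in> {0..T}" by (simp add: space_restrict_space)
    show "(\<integral>\<^sup>+\<xi>. q (\<Delta> (x t \<xi>) t) \<partial>M) = (\<integral>\<^sup>+y. q (\<Delta> y t) \<partial>marginal P t)"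
      using borel_measurable_section [OF \<Delta> q t] x [OF t]
      by (simp add: marginal_P [OF t] nn_integral_distr)
  qed
qed

lemma borel_measurable_energy_integrand:
  assumes "perturbation \<Delta>" "q \<in> borel_measurable borel"
    and A: "A \<in> sets lebesgue" "A \<subseteq> {0..T}"
  shows "(\<lambda>t. ennreal ((g t)\<^sup>2) * (\<integral>\<^sup>+y. q (\<Delta> y t) \<partial>marginal P t) * indicator A t)
    \<in> borel_measurable lebesgue"
proof -
  let ?h = "\<lambda>t. ennreal ((g t)\<^sup>2) * (\<integral>\<^sup>+y. q (\<Delta> y t) \<partial>marginal P t)"
  have "?h \<in> borel_measurable (restrict_space borel {0..T})"
    using g borel_measurable_mean [OF assms(1,2)] by measurable
  \<comment> \<open>The integrand is first extended by zero from \<open>{0..T}\<close> as a Borel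
    function. Passing to the completion then admits the set \<open>A\<close>, which is only Lebesgue
    measurable.\<close>
  then have "(\<lambda>t. ?h t * indicator {0..T} t) \<in> borel_measurable lborel"
    by (simp add: borel_measurable_restrict_space_iff_ennreal)
  then have "(\<lambda>t. ?h t * indicator {0..T} t) \<in> borel_measurable lebesgue"
    by (rule measurable_completion)
  then have "(\<lambda>t. ?h t * indicator {0..T} t * indicator A t) \<in> borel_measurable lebesgue"
    using A by measurable
  moreover have "?h t * indicator {0..T} t * indicator A t = ?h t * indicator A t" for t
    using A by (auto simp: indicator_def)
  ultimately show ?thesis by simp
qed

text \<open>With a factor on each side, one lemma serves both bounds: \<open>b = 1\<close> gives the
  lower bound inside the region, \<open>a = 1\<close> the upper bound outside.\<close>

lemma energy_mono_scaled:
  assumes \<Delta>: "perturbation \<Delta>" "perturbation \<Delta>'" and q: "q \<in> borel_measurable borel"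
    and A: "A \<in> sets lebesgue" "A \<subseteq> {0..T}"
    and le: "\<And>t y. t \<in> A \<Longrightarrow> a * q (\<Delta> y t) \<le> b * q (\<Delta>' y t)"
  shows "a * energy g P q \<Delta> A \<le> b * energy g P q \<Delta>' A"
proof -
  let ?E = "\<lambda>\<Delta> t. \<integral>\<^sup>+y. q (\<Delta> y t) \<partial>marginal P t"
  let ?h = "\<lambda>\<Delta> t. ennreal ((g t)\<^sup>2) * ?E \<Delta> t * indicator A t"
  have mean: "a * ?E \<Delta> t \<le> b * ?E \<Delta>' t" if t: "t \<in> A" for t
  proof -
    have t': "t \<in> {0..T}" using t A by auto
    have "a * ?E \<Delta> t = (\<integral>\<^sup>+y. a * q (\<Delta> y t) \<partial>marginal P t)"
      by (rule nn_integral_cmult [OF borel_measurable_section [OF \<Delta>(1) q t'], symmetric])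
    also have "\<dots> \<le> (\<integral>\<^sup>+y. b * q (\<Delta>' y t) \<partial>marginal P t)"
      by (intro nn_integral_mono le t)
    also have "\<dots> = b * ?E \<Delta>' t"
      by (rule nn_integral_cmult [OF borel_measurable_section [OF \<Delta>(2) q t']])
    finally show ?thesis .
  qed
  have "a * (\<integral>\<^sup>+t. ?h \<Delta> t \<partial>lebesgue) = (\<integral>\<^sup>+t. a * ?h \<Delta> t \<partial>lebesgue)"
    by (rule nn_integral_cmult [OF borel_measurable_energy_integrand [OF \<Delta>(1) q A], symmetric])
  also have "\<dots> \<le> (\<integral>\<^sup>+t. b * ?h \<Delta>' t \<partial>lebesgue)"
  proof (rule nn_integral_mono)
    \<comment> \<open>Off \<open>A\<close> both sides vanish; on \<open>A\<close> the bound on the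
      means is multiplied by the squared diffusion coefficient.\<close>
    fix t
    show "a * ?h \<Delta> t \<le> b * ?h \<Delta>' t"
      using mult_left_mono [OF mean, of t "ennreal ((g t)\<^sup>2)"]
      by (cases "t \<in> A") (simp_all add: mult_ac)
  qed
  also have "\<dots> = b * (\<integral>\<^sup>+t. ?h \<Delta>' t \<partial>lebesgue)"
    by (rule nn_integral_cmult [OF borel_measurable_energy_integrand [OF \<Delta>(2) q A]])
  finally show ?thesis
    unfolding energy_def mult.left_commute [of _ "ennreal (1/2)"]
    by (rule mult_left_mono) simp
qed

text \<open>This splits a divergence by frequency, with \<open>q\<close> and \<open>q'\<close> the
  energies in a band and in its complement.\<close>

lemma energy_add:
  assumes \<Delta>: "perturbation \<Delta>" and q: "q \<in> borel_measurable borel" "q' \<in> borel_measurable borel"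
  shows "energy g P q \<Delta> {0..T} + energy g P q' \<Delta> {0..T}
    = energy g P (\<lambda>v. q v + q' v) \<Delta> {0..T}"
proof -
  have A: "{0..T} \<in> sets lebesgue" "{0..T} \<subseteq> {0..T}" by auto
  have "(\<integral>\<^sup>+y. q (\<Delta> y t) + q' (\<Delta> y t) \<partial>marginal P t)
      = (\<integral>\<^sup>+y. q (\<Delta> y t) \<partial>marginal P t) + (\<integral>\<^sup>+y. q' (\<Delta> y t) \<partial>marginal P t)"
    if "t \<in> {0..T}" for t
    using that by (intro nn_integral_add borel_measurable_section \<Delta> q)
  then have "(\<integral>\<^sup>+t\<in>{0..T}. ennreal ((g t)\<^sup>2) *
        (\<integral>\<^sup>+y. q (\<Delta> y t) + q' (\<Delta> y t) \<partial>marginal P t) \<partial>lebesgue)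
      = (\<integral>\<^sup>+t. ennreal ((g t)\<^sup>2) * (\<integral>\<^sup>+y. q (\<Delta> y t) \<partial>marginal P t) * indicator {0..T} t
          + ennreal ((g t)\<^sup>2) * (\<integral>\<^sup>+y. q' (\<Delta> y t) \<partial>marginal P t) * indicator {0..T} t \<partial>lebesgue)"
    by (intro nn_integral_cong) (simp add: indicator_def distrib_left)
  also have "\<dots> = (\<integral>\<^sup>+t\<in>{0..T}. ennreal ((g t)\<^sup>2) * (\<integral>\<^sup>+y. q (\<Delta> y t) \<partial>marginal P t) \<partial>lebesgue)
      + (\<integral>\<^sup>+t\<in>{0..T}. ennreal ((g t)\<^sup>2) * (\<integral>\<^sup>+y. q' (\<Delta> y t) \<partial>marginal P t) \<partial>lebesgue)"
    by (intro nn_integral_add borel_measurable_energy_integrand \<Delta> q A)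
  finally show ?thesis
    by (simp add: energy_def distrib_left)
qed

lemma energy_Diff:
  assumes \<Delta>: "perturbation \<Delta>" and q: "q \<in> borel_measurable borel"
    and A: "A \<in> sets lebesgue" "A \<subseteq> {0..T}"
  shows "energy g P q \<Delta> A + energy g P q \<Delta> ({0..T} - A) = energy g P q \<Delta> {0..T}"
proof -
  have B: "{0..T} - A \<in> sets lebesgue" "{0..T} - A \<subseteq> {0..T}"
    using A by auto
  let ?h = "\<lambda>t. ennreal ((g t)\<^sup>2) * (\<integral>\<^sup>+y. q (\<Delta> y t) \<partial>marginal P t)"
  have "(\<integral>\<^sup>+t\<in>A. ?h t \<partial>lebesgue) + (\<integral>\<^sup>+t\<in>{0..T} - A. ?h t \<partial>lebesgue)
      = (\<integral>\<^sup>+t. ?h t * indicator A t + ?h t * indicator ({0..T} - A) t \<partial>lebesgue)"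
    by (intro nn_integral_add [symmetric] borel_measurable_energy_integrand \<Delta> q A B)
  also have "\<dots> = (\<integral>\<^sup>+t\<in>{0..T}. ?h t \<partial>lebesgue)"
    using A by (intro nn_integral_cong) (auto simp: indicator_def)
  finally show ?thesis
    by (simp add: energy_def distrib_left [symmetric])
qed

end


section \<open>Regional divergences as energies\<close>

definition sq_norm :: "real ^ 'd::finite \<Rightarrow> ennreal" where
  "sq_norm v = ennreal ((norm v)\<^sup>2)"

definition band_energy ::
  "('d::finite, 'c::finite, 'k::finite) image_layout \<Rightarrow> ('k \<Rightarrow> nat) set \<Rightarrow> real ^ 'd \<Rightarrow> ennreal" where
  "band_energy L W v = (\<Sum>\<omega>\<in>W. ennreal ((norm (unitary_dft L v \<omega>))\<^sup>2))"

lemma borel_measurable_sq_norm [measurable]: "sq_norm \<in> borel_measurable borel"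
  unfolding sq_norm_def [abs_def] by measurable

lemma borel_measurable_band_energy [measurable]: "band_energy L W \<in> borel_measurable borel"
  unfolding band_energy_def [abs_def] by measurable

lemma band_energy_compl:
  assumes "valid_layout L" "W \<subseteq> grid (grid_size L)"
  shows "band_energy L W v + band_energy L (grid (grid_size L) - W) v = sq_norm v"
proof -
  have "band_energy L W v + band_energy L (grid (grid_size L) - W) v
      = band_energy L (grid (grid_size L)) v"
    unfolding band_energy_def by (simp only: sum.subset_diff [OF assms(2) finite_grid] add.commute)
  then show ?thesis
    by (simp add: band_energy_def sq_norm_def plancherel_unitary_dft [OF assms(1)])
qed

lemma ennreal_mult_square_mono:
  assumes "0 \<le> a" "0 \<le> b" "0 \<le> c" "0 \<le> d" "a * c \<le> b * d"
  shows "ennreal (a\<^sup>2) * ennreal (c\<^sup>2) \<le> ennreal (b\<^sup>2) * ennreal (d\<^sup>2)"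
proof -
  have "(a * c)\<^sup>2 \<le> (b * d)\<^sup>2"
    using assms by (intro power_mono) auto
  then show ?thesis
    by (simp add: ennreal_mult [symmetric] power_mult_distrib ennreal_leI)
qed

lemma sq_norm_scaled_mono:
  assumes "0 \<le> a" "0 \<le> b" "a * norm u \<le> b * norm v"
  shows "ennreal (a\<^sup>2) * sq_norm u \<le> ennreal (b\<^sup>2) * sq_norm v"
  unfolding sq_norm_def using assms by (intro ennreal_mult_square_mono) auto

lemma band_energy_scaled_mono:
  assumes "0 \<le> a" "0 \<le> b"
    and "\<And>\<omega>. \<omega> \<in> W \<Longrightarrow> a * norm (unitary_dft L u \<omega>) \<le> b * norm (unitary_dft L v \<omega>)"
  shows "ennreal (a\<^sup>2) * band_energy L W u \<le> ennreal (b\<^sup>2) * band_energy L W v"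
  unfolding band_energy_def sum_distrib_left
  using assms by (intro sum_mono ennreal_mult_square_mono) auto

lemma girsanov_divergence_eq_energy: "girsanov_divergence T g P \<Delta> = energy g P sq_norm \<Delta> {0..T}"
  by (simp add: girsanov_divergence_def energy_def sq_norm_def)

context original_diffusion
begin

lemma regional_divergence_Times:
  "regional_divergence T g L P \<Delta> (Times W) = energy g P sq_norm \<Delta> W"
  by (simp add: energy_def sq_norm_def)

text \<open>By linearity, the sum over the band moves inside the expectation at each time in
  \<open>{0..T}\<close>; the indicator makes other times irrelevant.\<close>

lemma regional_divergence_Frequencies:
  assumes \<Delta>: "perturbation \<Delta>"
  shows "regional_divergence T g L P \<Delta> (Frequencies W) = energy g P (band_energy L W) \<Delta> {0..T}"
proof -
  have "(\<Sum>\<omega>\<in>W. \<integral>\<^sup>+y. ennreal ((norm (unitary_dft L (\<Delta> y t) \<omega>))\<^sup>2) \<partial>marginal P t)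
      = (\<integral>\<^sup>+y. band_energy L W (\<Delta> y t) \<partial>marginal P t)" if "t \<in> {0..T}" for t
    unfolding band_energy_def
    by (rule nn_integral_sum [symmetric],
        rule borel_measurable_section [OF \<Delta> _ that,
          where q = "\<lambda>v. ennreal ((norm (unitary_dft L v _))\<^sup>2)"]) measurable
  then show ?thesis
    unfolding energy_def regional_divergence.simps
    by (intro arg_cong [where f = "(*) (ennreal (1/2))"] nn_integral_cong) (simp add: indicator_def)
qed

lemma regional_divergence_compl:
  assumes \<Delta>: "perturbation \<Delta>" and L: "valid_layout L" and S: "is_region T L S"
  shows "regional_divergence T g L P \<Delta> S + regional_divergence T g L P \<Delta> (region_compl T L S)
    = girsanov_divergence T g P \<Delta>"
proof (cases S)
  case (Times W)
  then show ?thesis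
    using energy_Diff [OF \<Delta> borel_measurable_sq_norm, of W] S
    by (simp add: regional_divergence_Times girsanov_divergence_eq_energy
        del: regional_divergence.simps)
next
  case (Frequencies W)
  then have "W \<subseteq> grid (grid_size L)" using S by simp
  then show ?thesis
    \<comment> \<open>Plancherel's identity, in the form \<open>band_energy_compl\<close>, turns the
      sum of the two band energies into \<open>sq_norm\<close>.\<close>
    using energy_add [OF \<Delta>, of "band_energy L W" "band_energy L (grid (grid_size L) - W)"]
    by (simp add: Frequencies regional_divergence_Frequencies [OF \<Delta>] girsanov_divergence_eq_energy
        band_energy_compl [OF L] del: regional_divergence.simps)
qed

lemma regional_divergence_focused:
  assumes \<Delta>: "perturbation \<Delta>full" "perturbation \<Delta>sel" and S: "is_region T L S"
    and "0 \<le> \<mu>" "0 \<le> \<eta>" and focused: "focused_updates T L \<mu> \<eta> \<Delta>full \<Delta>sel S"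
  shows "ennreal (\<mu>\<^sup>2) * regional_divergence T g L P \<Delta>full S \<le> regional_divergence T g L P \<Delta>sel S"
    and "regional_divergence T g L P \<Delta>sel (region_compl T L S)
      \<le> ennreal (\<eta>\<^sup>2) * regional_divergence T g L P \<Delta>full (region_compl T L S)"
proof -
  \<comment> \<open>The factors \<open>1\<^sup>2\<close> bring both bounds to the shape of the
    scaled monotonicity lemmas, in which each factor is the square of a constant from the focusing
    assumption.\<close>
  have "ennreal (\<mu>\<^sup>2) * regional_divergence T g L P \<Delta>full S
        \<le> ennreal (1\<^sup>2) * regional_divergence T g L P \<Delta>sel S \<and>
      ennreal (1\<^sup>2) * regional_divergence T g L P \<Delta>sel (region_compl T L S)
        \<le> ennreal (\<eta>\<^sup>2) * regional_divergence T g L P \<Delta>full (region_compl T L S)"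
  proof (cases S)
    case (Times W)
    then have "W \<in> sets lebesgue" "W \<subseteq> {0..T}" using S by auto
    then show ?thesis
      unfolding Times region_compl.simps regional_divergence_Times
      using focused Times \<open>0 \<le> \<mu>\<close> \<open>0 \<le> \<eta>\<close>
      by (intro conjI energy_mono_scaled \<Delta> borel_measurable_sq_norm sq_norm_scaled_mono) auto
  next
    case (Frequencies W)
    then show ?thesis
      unfolding Frequencies region_compl.simps regional_divergence_Frequencies [OF \<Delta>(1)]
        regional_divergence_Frequencies [OF \<Delta>(2)]
      using focused Frequencies \<open>0 \<le> \<mu>\<close> \<open>0 \<le> \<eta>\<close>
      by (intro conjI energy_mono_scaled \<Delta> borel_measurable_band_energy band_energy_scaled_mono) auto
  qed
  then show "ennreal (\<mu>\<^sup>2) * regional_divergence T g L P \<Delta>full S \<le> regional_divergence T g L P \<Delta>sel S"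
    and "regional_divergence T g L P \<Delta>sel (region_compl T L S)
      \<le> ennreal (\<eta>\<^sup>2) * regional_divergence T g L P \<Delta>full (region_compl T L S)"
    by simp_all
qed

end

text \<open>In real numbers the gain is \<open>(a' - a) + \<beta> * (b - b')\<close>, which is at
  least \<open>(\<mu>\<^sup>2 - 1) * a + \<beta> * (1 - \<eta>\<^sup>2) * b\<close>. Here
  \<open>a\<close> and \<open>b\<close> are the fractions \<open>1 - l\<close> and \<open>l\<close>
  of the total.\<close>

lemma objective_gain:
  fixes A A' B B' K :: ennreal and \<mu> \<eta> \<beta> :: real
  assumes K: "A + B = K" "0 < K" "K < \<infinity>" and fin: "A' + B' < \<infinity>" and "0 \<le> \<beta>"
    and inside: "ennreal (\<mu>\<^sup>2) * A \<le> A'" and outside: "B' \<le> ennreal (\<eta>\<^sup>2) * B"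
  defines "l \<equiv> enn2real B / enn2real K"
  shows "l \<in> {0..1}"
    and "((\<mu>\<^sup>2 - 1) * (1 - l) + \<beta> * (1 - \<eta>\<^sup>2) * l) * enn2real K
      \<le> (enn2real A' - \<beta> * enn2real B') - (enn2real A - \<beta> * enn2real B)"
proof -
  \<comment> \<open>Each summand of a finite total is finite. This matters because
    \<open>enn2real\<close> sends infinity to 0.\<close>
  have "A < \<infinity>" "B < \<infinity>" "A' < \<infinity>" "B' < \<infinity>"
    using K fin by auto
  then obtain a b a' b' where
    r: "A = ennreal a" "B = ennreal b" "A' = ennreal a'" "B' = ennreal b'"
    and nn: "0 \<le> a" "0 \<le> b" "0 \<le> a'" "0 \<le> b'"
    by (metis ennreal_cases infinity_ennreal_def less_irrefl)
  have k: "K = ennreal (a + b)" and pos: "a + b > 0"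
    using K nn by (auto simp: r ennreal_plus [symmetric] simp del: ennreal_plus)
  have l: "l = b / (a + b)"
    using nn by (simp add: l_def k r del: ennreal_plus)
  then show "l \<in> {0..1}"
    using nn pos by simp
  have "\<mu>\<^sup>2 * a \<le> a'" "b' \<le> \<eta>\<^sup>2 * b"
    using inside outside nn by (simp_all add: r ennreal_mult [symmetric])
  moreover from this have "\<beta> * b' \<le> \<beta> * (\<eta>\<^sup>2 * b)"
    using \<open>0 \<le> \<beta>\<close> by (intro mult_left_mono)
  moreover have "l * (a + b) = b" "(1 - l) * (a + b) = a"
    using pos by (simp_all add: l field_simps)
  then have "((\<mu>\<^sup>2 - 1) * (1 - l) + \<beta> * (1 - \<eta>\<^sup>2) * l) * (a + b)
      = (\<mu>\<^sup>2 - 1) * a + \<beta> * (1 - \<eta>\<^sup>2) * b"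
    by (simp add: distrib_right mult.assoc)
  ultimately show "((\<mu>\<^sup>2 - 1) * (1 - l) + \<beta> * (1 - \<eta>\<^sup>2) * l) * enn2real K
      \<le> (enn2real A' - \<beta> * enn2real B') - (enn2real A - \<beta> * enn2real B)"
    using nn by (simp add: k r algebra_simps del: ennreal_plus)
qed

section \<open>Reduction of the diffusion setting to the energy estimates\<close>

theorem proposition3p1:
  fixes T :: real
    and f :: "real ^ 'd::finite \<Rightarrow> real \<Rightarrow> real ^ 'd"
    and g :: "real \<Rightarrow> real"
    and s :: "model \<Rightarrow> real ^ 'd \<Rightarrow> real \<Rightarrow> real ^ 'd"
    and M :: "model \<Rightarrow> 'w measure"
    and F :: "model \<Rightarrow> real \<Rightarrow> 'w measure"
    and w x :: "model \<Rightarrow> real \<Rightarrow> 'w \<Rightarrow> real ^ 'd"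
    and P :: "model \<Rightarrow> (real \<Rightarrow> real ^ 'd) measure"
    and \<Delta> :: "model \<Rightarrow> real ^ 'd \<Rightarrow> real \<Rightarrow> real ^ 'd"
    and L :: "('d, 'c::finite, 'k::finite) image_layout"
    and S :: "'k region"
    and \<mu> \<eta> lam \<beta> :: real
    and J :: "real \<Rightarrow> model \<Rightarrow> real"
  assumes T: "T > 0"
    and f: "(\<lambda>(y, t). f y t) \<in> borel_measurable (borel \<Otimes>\<^sub>M restrict_space borel {0..T})"
    and g: "g \<in> borel_measurable (restrict_space borel {0..T})"
    and s: "\<And>m. (\<lambda>(y, t). s m y t) \<in> borel_measurable (borel \<Otimes>\<^sub>M restrict_space borel {0..T})"
    and L: "valid_layout L"
    and sde: "\<And>m. reverse_diffusion T f g (s m) (M m) (F m) (w m) (x m)"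
    and P: "\<And>m. P m = path_measure T (M m) (x m)"
    and \<Delta>: "\<And>m y t. \<Delta> m y t = s m y t - s Orig y t"
    and girsanov: "\<And>m. m \<in> {Full, Sel} \<Longrightarrow>
          kl_div (P Orig) (P m) = girsanov_divergence T g (P Orig) (\<Delta> m)"
    and S: "is_region T L S"
    and finite_div: "\<And>m. m \<in> {Full, Sel} \<Longrightarrow> kl_div (P Orig) (P m) < \<infinity>"
    and pos_div: "kl_div (P Orig) (P Full) > 0"
    and \<mu>: "\<mu> \<ge> 1"
    and \<eta>: "\<eta> \<in> {0..1}"
    and focused: "focused_updates T L \<mu> \<eta> (\<Delta> Full) (\<Delta> Sel) S"
    and J: "\<And>b m. J b m =
          enn2real (regional_divergence T g L (P Orig) (\<Delta> m) S)
          - b * enn2real (regional_divergence T g L (P Orig) (\<Delta> m) (region_compl T L S))"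
    and lam: "lam =
          enn2real (regional_divergence T g L (P Orig) (\<Delta> Full) (region_compl T L S))
          / enn2real (kl_div (P Orig) (P Full))"
    and \<beta>: "\<beta> > 0"
  shows "lam \<in> {0..1} \<and>
         J \<beta> Sel - J \<beta> Full \<ge>
           ((\<mu>\<^sup>2 - 1) * (1 - lam) + \<beta> * (1 - \<eta>\<^sup>2) * lam) * enn2real (kl_div (P Orig) (P Full))"
proof -
  have diffusion: "reverse_diffusion T f g (s Orig) (M Orig) (F Orig) (w Orig) (x Orig)"
    by (rule sde)
  then have bm: "reverse_brownian_motion T (M Orig) (F Orig) (w Orig)"
    and adapted: "\<forall>t\<in>{0..T}. x Orig t \<in> borel_measurable (F Orig t)"
    and cont: "\<forall>\<xi>\<in>space (M Orig). continuous_on {0..T} (\<lambda>t. x Orig t \<xi>)"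
    unfolding reverse_diffusion_def by blast+
  interpret original_diffusion T g "M Orig" "x Orig" "P Orig"
  proof (rule original_diffusion.intro)
    show "prob_space (M Orig)"
      using bm by (simp add: reverse_brownian_motion_def)
    \<comment> \<open>Adaptedness gives measurability for \<open>F Orig t\<close>, a subalgebra of
      \<open>M Orig\<close>.\<close>
    show "x Orig t \<in> borel_measurable (M Orig)" if "t \<in> {0..T}" for t
      using bm adapted that unfolding reverse_brownian_motion_def
      by (blast intro: measurable_from_subalg)
  qed (use T g cont P in auto)
  have \<Delta>_meas: "perturbation (\<Delta> m)" for m
    using borel_measurable_diff [OF s [of m] s [of Orig]]
    by (simp add: perturbation_def \<Delta> split_beta)
  let ?D = "\<lambda>m. regional_divergence T g L (P Orig) (\<Delta> m)"
  \<comment> \<open>Girsanov's formula identifies the sum of the regional divergences with the KL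
    divergence. The \<open>Full\<close> instance fixes the total in \<open>lam\<close>; the
    \<open>Sel\<close> instance gives finiteness of both regional terms.\<close>
  have split: "?D m S + ?D m (region_compl T L S) = kl_div (P Orig) (P m)" if "m \<in> {Full, Sel}" for m
    using regional_divergence_compl [OF \<Delta>_meas L S] girsanov [OF that] by simp
  have "ennreal (\<mu>\<^sup>2) * ?D Full S \<le> ?D Sel S"
    and "?D Sel (region_compl T L S) \<le> ennreal (\<eta>\<^sup>2) * ?D Full (region_compl T L S)"
    using regional_divergence_focused [OF \<Delta>_meas \<Delta>_meas S _ _ focused] \<mu> \<eta> by auto
  from objective_gain [OF split [of Full] pos_div finite_div _ _ this, of \<beta>]
  show ?thesis
    using split [of Sel] finite_div [of Sel] \<beta> by (simp add: J lam)
qed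

end
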